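(* Let $\nu^-<\nu^+$ be real numbers, and let $\frac{p}{q}\in S_{\nu^-,\nu^+}$ be a rational number, where $p\in\mathbb{Z}$, $q\in\mathbb{Z}^+$ and the fraction $\frac{p}{q}$ is irreducible. Suppose that $\frac{p-1}{q}=\nu^-$, $\frac{p+1}{q}=\nu^+$ and $q$ is odd. Then there is no $f\in\mathcal{M}$ with $\nu(f^-)=\nu^-$, $\nu(f^+)=\nu^+$ and $\nu(f)=\frac{p}{q}$.
   Context: $\mathcal{M}$ is the set of functions $f:\mathbb{R}\to\mathbb{R}$ (not necessarily continuous, injective or surjective) such that $y>0\Rightarrow f(x+y)\geqslant f(x)$ and $f(x+1)=f(x)+1$ for all $x$. For $f\in\mathcal{M}$, the rotation number is $\nu(f)=\lim_{n\to\infty}\frac{f^n(x)}{n}$, where $f^n$ is the $n$-th iterate; it is known that this limit exists and is independent of $x\in\mathbb{R}$. For $f\in\mathcal{M}$, the functions $f^-,f^+\in\mathcal{M}$ are the one-sided limits $f^-(x)=\lim_{\delta\to0,\,\delta>0}f(x-\delta)$ and $f^+(x)=\lim_{\delta\to0,\,\delta>0}f(x+\delta)$. For real numbers $\nu^-<\nu^+$, $$S_{\nu^-,\nu^+}=\left\{\frac{\lfloor q\,\nu^-\rfloor+1}{q}\ :\ q\in\mathbb{Z}^+,\ \lceil q\,\nu^+\rceil=\lfloor q\,\nu^-\rfloor+2\right\},$$ where $\lfloor\cdot\rfloor$ and $\lceil\cdot\rceil$ are the floor and ceiling functions. "Irreducible" means $\gcd(p,q)=1$ with $q>0$. *)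

theory Defs
  imports "HOL-Analysis.Analysis"
begin

definition lift_maps :: "(real \<Rightarrow> real) set" where
  "lift_maps = {f. (\<forall>x y. y > 0 \<longrightarrow> f (x + y) \<ge> f x) \<and> (\<forall>x. f (x + 1) = f x + 1)}"

(* For f in lift_maps the limit exists and does not depend on x, so the description is proper;
   outside lift_maps the value may be unspecified. *)
definition rotation_number :: "(real \<Rightarrow> real) \<Rightarrow> real" where
  "rotation_number f = (THE \<nu>. \<forall>x. (\<lambda>n. (f ^^ n) x / real n) \<longlonglongrightarrow> \<nu>)"

(* Lim is again a definite description; both limits exist when f is monotone. *)
definition left_lim :: "(real \<Rightarrow> real) \<Rightarrow> real \<Rightarrow> real" where
  "left_lim f x = Lim (at_left x) f"

definition right_lim :: "(real \<Rightarrow> real) \<Rightarrow> real \<Rightarrow> real" where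
  "right_lim f x = Lim (at_right x) f"

definition S_set :: "real \<Rightarrow> real \<Rightarrow> real set" where
  "S_set \<nu>m \<nu>p =
     {real_of_int (\<lfloor>real_of_int q * \<nu>m\<rfloor> + 1) / real_of_int q | q :: int.
        q > 0 \<and> \<lceil>real_of_int q * \<nu>p\<rceil> = \<lfloor>real_of_int q * \<nu>m\<rfloor> + 2}"

end

theory Submission
  imports Defs
begin

text \<open>
  If \<open>f\<close> has rotation number \<open>p/q\<close> but \<open>f\<^sup>q - p\<close> has no fixed point, then the orbits of
  \<open>f\<^sup>q - p\<close> are strictly monotone and bounded, and their limit \<open>z\<close> satisfies
  \<open>g\<^sup>q z = z + p\<close> for \<open>g = f\<^sup>-\<close> or \<open>g = f\<^sup>+\<close>, which would then have rotation number \<open>p/q\<close> as well.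
  So \<open>f\<close> has a periodic orbit; list it in increasing order as \<open>y i\<close>, where
  \<open>y (i + q) = y i + 1\<close> and \<open>f (y i) = y (i + p)\<close>. Monotonicity gives
  \<open>f\<^sup>+ (y i) \<le> y (i + p + 1)\<close>, and the rotation number of \<open>f\<^sup>+\<close> can only be \<open>(p + 1)/q\<close> if
  equality holds along a whole coset of the subgroup generated by \<open>p + 1\<close> and \<open>q\<close>. Symmetrically
  \<open>f\<^sup>- (y i) = y (i + p - 1)\<close> along a coset of the subgroup generated by \<open>p - 1\<close> and \<open>q\<close>. For odd
  \<open>q\<close> the numbers \<open>p + 1\<close>, \<open>p - 1\<close>, \<open>q\<close> have no common factor, so some \<open>J\<close> lies in the first
  coset while \<open>J + 1\<close> lies in the second. Then \<open>f\<close> would be constant on the gap between \<open>y J\<close> and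
  \<open>y (J + 1)\<close> with the two values \<open>y (J + p + 1)\<close> and \<open>y (J + p)\<close>.
\<close>

section \<open>Degree one monotone maps and their displacement\<close>

lemma lift_maps_iff: "f \<in> lift_maps \<longleftrightarrow> mono f \<and> (\<forall>x. f (x + 1) = f x + 1)"
proof
  assume f: "f \<in> lift_maps"
  have "f x \<le> f y" if "x \<le> y" for x y
  proof (cases "x = y")
    case False
    then have "y - x > 0" using that by simp
    then have "f (x + (y - x)) \<ge> f x" using f unfolding lift_maps_def by blast
    then show ?thesis by simp
  qed simp
  then show "mono f \<and> (\<forall>x. f (x + 1) = f x + 1)"
    using f by (auto simp: lift_maps_def mono_def)
next
  assume "mono f \<and> (\<forall>x. f (x + 1) = f x + 1)"
  then show "f \<in> lift_maps" by (auto simp: lift_maps_def intro: monoD)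
qed

lemma lift_maps_mono: "f \<in> lift_maps \<Longrightarrow> x \<le> y \<Longrightarrow> f x \<le> f y"
  by (auto simp: lift_maps_iff dest: monoD)

lemma lift_maps_add_nat: "f \<in> lift_maps \<Longrightarrow> f (x + of_nat n) = f x + of_nat n"
proof (induction n)
  case (Suc n)
  have "f (x + of_nat (Suc n)) = f ((x + of_nat n) + 1)" by (simp add: add_ac)
  also have "\<dots> = f (x + of_nat n) + 1" using Suc.prems lift_maps_iff by blast
  finally show ?case using Suc by simp
qed simp

lemma lift_maps_add_int:
  assumes "f \<in> lift_maps" shows "f (x + of_int m) = f x + of_int m"
proof (cases m)
  case (nonneg n)
  then show ?thesis using lift_maps_add_nat[OF assms] by simp
next
  case (neg n)
  then show ?thesis using lift_maps_add_nat[OF assms, of "x + of_int m" "Suc n"] by simp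
qed

lemma lift_maps_funpow: "f \<in> lift_maps \<Longrightarrow> (f ^^ n) \<in> lift_maps"
  by (induction n) (auto simp: lift_maps_iff mono_def)

text \<open>With \<open>m\<close> the floor of \<open>x - y\<close>, monotonicity squeezes
  \<open>f x\<close> between \<open>f y + m\<close> and \<open>f y + m + 1\<close>.\<close>

lemma lift_maps_displacement:
  assumes "f \<in> lift_maps" shows "\<bar>(f x - x) - (f y - y)\<bar> \<le> 1"
proof -
  define m where "m = \<lfloor>x - y\<rfloor>"
  have m: "of_int m \<le> x - y" "x - y < of_int m + 1" unfolding m_def by linarith+
  have "f (y + of_int m) \<le> f x" "f x \<le> f (y + of_int (m + 1))"
    using m by (auto intro!: lift_maps_mono[OF assms])
  then show ?thesis using m by (simp only: lift_maps_add_int[OF assms])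
qed

text \<open>The displacement of \<open>f ^^ (k * n)\<close> is a sum of \<open>k\<close>
  displacements of \<open>f ^^ n\<close> along the orbit of \<open>x\<close>, each within 1 of the
  one at \<open>x\<close>.\<close>

lemma funpow_displacement_mult:
  assumes "f \<in> lift_maps"
  shows "\<bar>((f ^^ (k * n)) x - x) - real k * ((f ^^ n) x - x)\<bar> \<le> real k"
proof (induction k)
  case (Suc k)
  have "(f ^^ (Suc k * n)) x = (f ^^ n) ((f ^^ (k * n)) x)" by (simp add: funpow_add)
  moreover have "\<bar>((f ^^ n) ((f ^^ (k * n)) x) - (f ^^ (k * n)) x) - ((f ^^ n) x - x)\<bar> \<le> 1"
    by (intro lift_maps_displacement lift_maps_funpow assms)
  ultimately show ?case using Suc by (simp add: algebra_simps)
qed simp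

section \<open>Existence of the rotation number\<close>

text \<open>The means over \<open>m\<close> and over \<open>n\<close> steps are both compared with
  the mean over \<open>m * n\<close> steps, from which they differ by at most \<open>1 / m\<close>
  and \<open>1 / n\<close>; so the means form a Cauchy sequence.\<close>

lemma convergent_mean_displacement:
  assumes "f \<in> lift_maps"
  shows "convergent (\<lambda>n. ((f ^^ n) x - x) / real n)"
proof -
  let ?d = "\<lambda>n. (f ^^ n) x - x"
  have half: "\<bar>?d (m * n) / (m * n) - ?d n / n\<bar> \<le> 1 / n" if "m > 0" "n > 0" for m n
  proof -
    have "?d (m * n) / (m * n) - ?d n / n = (?d (m * n) - m * ?d n) / (m * n)"
      using that by (simp add: field_simps)
    then have "\<bar>?d (m * n) / (m * n) - ?d n / n\<bar> = \<bar>?d (m * n) - m * ?d n\<bar> / (m * n)"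
      by simp
    also have "\<dots> \<le> m / (m * n)"
      using funpow_displacement_mult[OF assms, of m n x] by (rule divide_right_mono) simp
    finally show ?thesis using that by simp
  qed
  have near: "\<bar>?d m / m - ?d n / n\<bar> \<le> 1 / m + 1 / n" if "m > 0" "n > 0" for m n
    using half[of m n] half[of n m] that by (simp add: mult.commute)
  have "Cauchy (\<lambda>n. ?d n / real n)"
  proof (rule metric_CauchyI)
    fix e :: real assume e: "e > 0"
    obtain N :: nat where N: "real N > 2 / e" using reals_Archimedean2 by blast
    have "N > 0" using less_trans[OF divide_pos_pos[OF zero_less_numeral e] N] by simp
    have "dist (?d m / m) (?d n / n) < e" if "m \<ge> N" "n \<ge> N" for m n
    proof -
      have "1 / real k < e / 2" if "k \<ge> N" for k
      proof -
        have "real k > 2 / e" using N that by simp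
        then show ?thesis using e \<open>N > 0\<close> that by (simp add: field_simps)
      qed
      from this[OF that(1)] this[OF that(2)] near[of m n] show ?thesis
        using that \<open>N > 0\<close> by (simp add: dist_real_def)
    qed
    then show "\<exists>N. \<forall>m\<ge>N. \<forall>n\<ge>N. dist (?d m / m) (?d n / n) < e" by blast
  qed
  then show ?thesis by (simp add: Cauchy_convergent_iff)
qed

text \<open>Discharges the definite description in \<open>rotation_number\<close>: the limit exists
  for the orbit of 0, and any other orbit stays at bounded distance from that one.\<close>

lemma rotation_number_tendsto:
  assumes "f \<in> lift_maps"
  shows "(\<lambda>n. (f ^^ n) x / real n) \<longlonglongrightarrow> rotation_number f"
proof -
  obtain \<nu> where \<nu>: "(\<lambda>n. ((f ^^ n) 0 - 0) / real n) \<longlonglongrightarrow> \<nu>"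
    using convergent_mean_displacement[OF assms, of 0] by (auto simp: convergent_def)
  have lim: "(\<lambda>n. (f ^^ n) x / real n) \<longlonglongrightarrow> \<nu>" for x
  proof -
    have bound: "norm ((f ^^ n) x / real n - (f ^^ n) 0 / real n) \<le> (\<bar>x\<bar> + 1) / real n" for n
    proof -
      have "\<bar>(f ^^ n) x - (f ^^ n) 0\<bar> \<le> \<bar>x\<bar> + 1"
        using lift_maps_displacement[OF lift_maps_funpow[OF assms], of n x 0] by linarith
      then show ?thesis by (simp add: diff_divide_distrib[symmetric] divide_right_mono)
    qed
    have "(\<lambda>n. (f ^^ n) x / real n - (f ^^ n) 0 / real n) \<longlonglongrightarrow> 0"
      by (rule Lim_null_comparison[OF always_eventually lim_const_over_n]) (use bound in blast)
    from tendsto_add[OF this \<nu>] show ?thesis by simp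
  qed
  have "rotation_number f = \<nu>" unfolding rotation_number_def
    using lim by (intro the_equality) (auto intro: LIMSEQ_unique)
  then show ?thesis using lim by simp
qed

lemma rotation_number_unique:
  assumes "f \<in> lift_maps" "(\<lambda>n. (f ^^ n) x / real n) \<longlonglongrightarrow> l"
  shows "rotation_number f = l"
  using rotation_number_tendsto[OF assms(1)] assms(2) LIMSEQ_unique by blast

text \<open>Conjugation by the map taking \<open>x\<close> to \<open>- x\<close>. It swaps left and
  right limits and negates rotation numbers, so one-sided arguments need to be carried out on one
  side only.\<close>

definition reflect :: "(real \<Rightarrow> real) \<Rightarrow> real \<Rightarrow> real" where
  "reflect f x = - f (- x)"

lemma lift_maps_reflect:
  assumes "f \<in> lift_maps" shows "reflect f \<in> lift_maps"
proof -
  have "f (- x - 1) = f (- x) - 1" for x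
    using lift_maps_add_int[OF assms, of "- x" "- 1"] by simp
  then show ?thesis using assms by (auto simp: lift_maps_iff reflect_def mono_def)
qed

lemma reflect_funpow: "(reflect f ^^ n) x = - (f ^^ n) (- x)"
  by (induction n) (auto simp: reflect_def)

lemma rotation_number_reflect:
  assumes "f \<in> lift_maps" shows "rotation_number (reflect f) = - rotation_number f"
  using tendsto_minus[OF rotation_number_tendsto[OF assms, of 0]]
  by (intro rotation_number_unique[of _ 0] lift_maps_reflect assms) (simp add: reflect_funpow)

section \<open>Rational bounds on the rotation number\<close>

text \<open>The inequality iterates because \<open>f ^^ n\<close> commutes with integer
  translations; dividing by \<open>n * k\<close> and letting \<open>k\<close> grow gives the bound
  along a subsequence.\<close>

lemma rotation_number_le:
  assumes "f \<in> lift_maps" "n > 0" "(f ^^ n) x \<le> x + of_int m"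
  shows "rotation_number f \<le> of_int m / real n"
proof -
  have iter: "(f ^^ (n * k)) x \<le> x + of_int (m * int k)" for k
  proof (induction k)
    case (Suc k)
    have "(f ^^ (n * Suc k)) x = (f ^^ n) ((f ^^ (n * k)) x)" by (simp add: funpow_add)
    also have "\<dots> \<le> (f ^^ n) (x + of_int (m * int k))"
      by (rule lift_maps_mono[OF lift_maps_funpow[OF assms(1)] Suc])
    also have "\<dots> = (f ^^ n) x + of_int (m * int k)"
      by (rule lift_maps_add_int[OF lift_maps_funpow[OF assms(1)]])
    finally show ?case using assms(3) by (simp add: algebra_simps)
  qed simp
  have "strict_mono (\<lambda>k. n * k)" using assms(2) by (auto simp: strict_mono_def)
  from LIMSEQ_subseq_LIMSEQ[OF rotation_number_tendsto[OF assms(1), of x] this]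
  have lhs: "(\<lambda>k. (f ^^ (n * k)) x / real (n * k)) \<longlonglongrightarrow> rotation_number f" by (simp add: o_def)
  have "(\<lambda>k. x / real n / real k + of_int m / real n) \<longlonglongrightarrow> 0 + of_int m / real n"
    by (intro tendsto_add lim_const_over_n tendsto_const)
  moreover have "\<forall>\<^sub>F k in sequentially. (f ^^ (n * k)) x / real (n * k) \<le> x / real n / real k + of_int m / real n"
    using eventually_gt_at_top[of 0]
  proof eventually_elim
    case (elim k)
    have "(f ^^ (n * k)) x / real (n * k) \<le> (x + of_int (m * int k)) / real (n * k)"
      using iter by (intro divide_right_mono) auto
    also have "\<dots> = x / real n / real k + of_int m / real n"
      using elim assms(2) by (simp add: field_simps)
    finally show ?case .
  qed
  ultimately show ?thesis using tendsto_le[OF _ _ lhs] by fastforce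
qed

lemma rotation_number_ge:
  assumes "f \<in> lift_maps" "n > 0" "(f ^^ n) x \<ge> x + of_int m"
  shows "rotation_number f \<ge> of_int m / real n"
  using rotation_number_le[OF lift_maps_reflect[OF assms(1)] assms(2), of "- x" "- m"] assms
  by (simp add: reflect_funpow rotation_number_reflect)

lemma rotation_number_eq:
  assumes "f \<in> lift_maps" "n > 0" "(f ^^ n) x = x + of_int m"
  shows "rotation_number f = of_int m / real n"
  using rotation_number_le[OF assms(1,2), of x m] rotation_number_ge[OF assms(1,2), of x m] assms(3)
  by simp

section \<open>One-sided limits\<close>

lemma right_lim_tendsto:
  assumes "f \<in> lift_maps" shows "(f \<longlongrightarrow> right_lim f x) (at_right x)"
proof -
  have "((f \<longlongrightarrow> Inf (f ` ({x<..} \<inter> UNIV))) (at x within ({x<..} \<inter> UNIV)))"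
    by (rule Lim_right_bound[where K = "f x"]) (auto intro!: lift_maps_mono[OF assms])
  then have *: "(f \<longlongrightarrow> Inf (f ` {x<..})) (at_right x)" by simp
  then have "right_lim f x = Inf (f ` {x<..})" unfolding right_lim_def
    by (intro tendsto_Lim) auto
  then show ?thesis using * by simp
qed

lemma right_lim_reflect:
  assumes "f \<in> lift_maps" shows "right_lim (reflect f) x = - left_lim f (- x)"
proof -
  have "((\<lambda>y. - reflect f (- y)) \<longlongrightarrow> - right_lim (reflect f) x) (at_left (- x))"
    using right_lim_tendsto[OF lift_maps_reflect[OF assms], of x]
    by (intro tendsto_minus) (simp add: at_right_minus[of x] filterlim_filtermap)
  then have "left_lim f (- x) = - right_lim (reflect f) x" unfolding left_lim_def
    by (intro tendsto_Lim) (auto simp: reflect_def)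
  then show ?thesis by simp
qed

lemma right_lim_ge:
  assumes "f \<in> lift_maps" shows "f x \<le> right_lim f x"
  by (rule tendsto_lowerbound[OF right_lim_tendsto[OF assms]])
     (auto simp: eventually_at_right_less lift_maps_mono[OF assms] eventually_at_filter)

lemma right_lim_le:
  assumes "f \<in> lift_maps" "x < y" shows "right_lim f x \<le> f y"
proof (rule tendsto_upperbound[OF right_lim_tendsto[OF assms(1)]])
  show "\<forall>\<^sub>F z in at_right x. f z \<le> f y"
    using eventually_at_right_real[OF assms(2)]
    by eventually_elim (auto intro!: lift_maps_mono[OF assms(1)])
qed auto

lemma lift_maps_right_lim:
  assumes "f \<in> lift_maps" shows "right_lim f \<in> lift_maps"
  unfolding lift_maps_iff
proof (intro conjI allI monoI)
  fix x y :: real assume "x \<le> y"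
  then show "right_lim f x \<le> right_lim f y"
    using right_lim_le[OF assms, of x y] right_lim_ge[OF assms, of y] by (cases "x = y") auto
next
  fix x
  have "((\<lambda>z. f (z + 1)) \<longlongrightarrow> right_lim f (x + 1)) (at_right x)"
    using right_lim_tendsto[OF assms, of "x + 1"]
    unfolding filterlim_at_right_to_0[of _ _ "x + 1"] filterlim_at_right_to_0[of _ _ x]
    by (simp add: add.assoc)
  moreover have "((\<lambda>z. f (z + 1)) \<longlongrightarrow> right_lim f x + 1) (at_right x)"
    using tendsto_add[OF right_lim_tendsto[OF assms, of x] tendsto_const[of 1]] assms
    by (simp add: lift_maps_iff)
  ultimately show "right_lim f (x + 1) = right_lim f x + 1"
    using tendsto_unique[OF trivial_limit_at_right_real] by blast
qed

text \<open>Strict increase keeps \<open>u\<close> strictly below \<open>l\<close>, so the value of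
  \<open>f\<close> at \<open>l\<close> itself, where \<open>f\<close> may jump, never
  enters.\<close>

lemma left_lim_increasing:
  assumes "f \<in> lift_maps" and "\<And>n. u n < u (Suc n)" and "u \<longlonglongrightarrow> l"
  shows "(\<lambda>n. f (u n)) \<longlonglongrightarrow> left_lim f l"
proof -
  have "left_lim f l = - right_lim (reflect f) (- l)" using right_lim_reflect[OF assms(1)] by simp
  moreover have "((\<lambda>x. - reflect f (- x)) \<longlongrightarrow> - right_lim (reflect f) (- l)) (at_left l)"
    using right_lim_tendsto[OF lift_maps_reflect[OF assms(1)], of "- l"]
    by (intro tendsto_minus) (simp add: at_right_minus[of "- l"] filterlim_filtermap)
  ultimately have "(f \<longlongrightarrow> left_lim f l) (at_left l)" by (simp add: reflect_def)
  moreover have "filterlim u (at_left l) sequentially"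
  proof (rule tendsto_imp_filterlim_at_left[OF assms(3)])
    have "u n < l" for n
      using assms(2)[of n] incseq_le[OF incseq_SucI assms(3), of "Suc n"] assms(2)
      by (meson less_imp_le less_le_trans)
    then show "\<forall>\<^sub>F n in sequentially. u n < l" by simp
  qed
  ultimately show ?thesis by (rule filterlim_compose)
qed

section \<open>Periodic points at a rational rotation number\<close>

lemma left_lim_periodic_point:
  assumes f: "f \<in> lift_maps" and q: "q > 0" and rot: "rotation_number f = of_int p / real q"
    and nofix: "\<And>x. (f ^^ q) x \<noteq> x + of_int p" and up: "(f ^^ q) x > x + of_int p"
  shows "\<exists>z. (left_lim f ^^ q) z = z + of_int p"
proof -
  \<comment> \<open>Row \<open>n\<close> is the orbit of \<open>x\<close> after \<open>q * n\<close>
    steps, translated back by \<open>p * n\<close>; its column \<open>i\<close> lies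
    \<open>i\<close> steps further on.\<close>
  define u where "u n i = (f ^^ (q * n + i)) x - of_int p * real n" for n i
  have u_f: "(f ^^ i) (u n 0) = u n i" for n i
  proof -
    have "(f ^^ i) (u n 0) = (f ^^ i) ((f ^^ (q * n)) x + of_int (- p * int n))"
      by (simp add: u_def)
    also have "\<dots> = (f ^^ i) ((f ^^ (q * n)) x) + of_int (- p * int n)"
      by (rule lift_maps_add_int[OF lift_maps_funpow[OF f]])
    finally show ?thesis by (simp add: u_def funpow_add add.commute[of _ i])
  qed
  have u_q: "u n q = u (Suc n) 0 + of_int p" for n
    by (simp add: u_def algebra_simps)
  have less0: "u n 0 < u (Suc n) 0" for n
  proof (induction n)
    case 0
    then show ?case using up by (simp add: u_def)
  next
    case (Suc n)
    have "(f ^^ q) (u n 0) \<le> (f ^^ q) (u (Suc n) 0)"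
      using Suc by (intro lift_maps_mono[OF lift_maps_funpow[OF f]]) simp
    then have "u (Suc n) 0 \<le> u (Suc (Suc n)) 0" by (simp add: u_f u_q)
    moreover have "u (Suc n) 0 \<noteq> u (Suc (Suc n)) 0"
      using nofix[of "u (Suc n) 0"] by (simp add: u_f u_q)
    ultimately show ?case by simp
  qed
  \<comment> \<open>Every column must increase strictly, since \<open>left_lim_increasing\<close> is
    applied at each of the \<open>q\<close> steps. A failure in column \<open>i\<close> would be
    carried by \<open>f ^^ (q - i)\<close> to column \<open>q\<close>, against
    \<open>less0\<close>.\<close>
  have less: "u n i < u (Suc n) i" if "i \<le> q" for n i
  proof (rule ccontr)
    assume "\<not> u n i < u (Suc n) i"
    then have "(f ^^ (q - i)) (u (Suc n) i) \<le> (f ^^ (q - i)) (u n i)"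
      by (intro lift_maps_mono[OF lift_maps_funpow[OF f]]) simp
    moreover have "(f ^^ (q - i)) (u m i) = u m q" for m
    proof -
      have "(f ^^ (q - i)) ((f ^^ i) (u m 0)) = (f ^^ q) (u m 0)"
        using that by (metis comp_apply funpow_add le_add_diff_inverse2)
      then show ?thesis by (simp add: u_f)
    qed
    ultimately show False using less0[of "Suc n"] by (simp add: u_q)
  qed
  \<comment> \<open>An excess over \<open>x + 1\<close> would push the rotation number up to at
    least \<open>(p * n + 1) / (q * n)\<close>, which exceeds \<open>p / q\<close>.\<close>
  have "u n 0 \<le> x + 1" for n
  proof (rule ccontr)
    assume "\<not> u n 0 \<le> x + 1"
    then have *: "(f ^^ (q * n)) x \<ge> x + of_int (p * int n + 1)" and "n > 0"
      by (auto simp: u_def intro!: Nat.gr0I)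
    from rotation_number_ge[OF f _ *] q \<open>n > 0\<close>
    have "of_int (p * int n + 1) / real (q * n) \<le> of_int p / real q" by (simp add: rot)
    then show False using q \<open>n > 0\<close> by (simp add: field_simps)
  qed
  moreover have "incseq (\<lambda>n. u n 0)" using less0 by (intro incseq_SucI less_imp_le)
  ultimately obtain z where z: "(\<lambda>n. u n 0) \<longlonglongrightarrow> z"
    using incseq_convergent[of "\<lambda>n. u n 0" "x + 1"] by blast
  have "i \<le> q \<Longrightarrow> (\<lambda>n. u n i) \<longlonglongrightarrow> (left_lim f ^^ i) z" for i
  proof (induction i)
    case 0
    then show ?case using z by simp
  next
    case (Suc i)
    have "(\<lambda>n. f (u n i)) \<longlonglongrightarrow> left_lim f ((left_lim f ^^ i) z)"
      using Suc by (intro left_lim_increasing f less) auto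
    moreover have "f (u n i) = u n (Suc i)" for n by (simp add: u_def)
      (use lift_maps_add_int[OF f, of "(f ^^ (q * n + i)) x" "- p * int n"] in simp)
    ultimately show ?case by simp
  qed
  from this[of q] have "(\<lambda>n. u (Suc n) 0 + of_int p) \<longlonglongrightarrow> (left_lim f ^^ q) z"
    by (simp add: u_q)
  moreover have "(\<lambda>n. u (Suc n) 0 + of_int p) \<longlonglongrightarrow> z + of_int p"
    by (intro tendsto_intros LIMSEQ_Suc z)
  ultimately show ?thesis using LIMSEQ_unique by blast
qed

lemma left_lim_conv_reflect:
  assumes "f \<in> lift_maps" shows "left_lim f = reflect (right_lim (reflect f))"
  using right_lim_reflect[OF assms] by (auto simp: reflect_def fun_eq_iff)

lemma reflect_reflect [simp]: "reflect (reflect f) = f"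
  by (simp add: reflect_def fun_eq_iff)

lemma lift_maps_left_lim: "f \<in> lift_maps \<Longrightarrow> left_lim f \<in> lift_maps"
  by (simp add: left_lim_conv_reflect lift_maps_reflect lift_maps_right_lim)

text \<open>Without a periodic point, the orbit of 0 under \<open>f ^^ q\<close> minus
  \<open>p\<close> moves up or down. Moving up yields a periodic point of the left limit; moving
  down is the same situation for \<open>reflect f\<close> and yields one of the right limit.\<close>

lemma rational_rotation_number_cases:
  assumes f: "f \<in> lift_maps" and q: "q > 0" and rot: "rotation_number f = of_int p / real q"
  obtains (periodic) x where "(f ^^ q) x = x + of_int p"
    | (left) "rotation_number (left_lim f) = rotation_number f"
    | (right) "rotation_number (right_lim f) = rotation_number f"
proof (cases "\<exists>x. (f ^^ q) x = x + of_int p")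
  case False
  then consider "(f ^^ q) 0 > 0 + of_int p" | "(f ^^ q) 0 < 0 + of_int p"
    by (metis linorder_neqE)
  then show ?thesis
  proof cases
    case 1
    then obtain z where "(left_lim f ^^ q) z = z + of_int p"
      using left_lim_periodic_point[OF f q rot] False by blast
    then have "rotation_number (left_lim f) = of_int p / real q"
      by (rule rotation_number_eq[OF lift_maps_left_lim[OF f] q])
    then show ?thesis using left rot by simp
  next
    case 2
    let ?h = "reflect f"
    have h: "?h \<in> lift_maps" and rot_h: "rotation_number ?h = of_int (- p) / real q"
      using f rot by (simp_all add: lift_maps_reflect rotation_number_reflect)
    have "(?h ^^ q) x \<noteq> x + of_int (- p)" for x
    proof
      assume "(?h ^^ q) x = x + of_int (- p)"
      then have "(f ^^ q) (- x) = - x + of_int p" by (simp add: reflect_funpow)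
      then show False using False by blast
    qed
    moreover have "(?h ^^ q) 0 > 0 + of_int (- p)" using 2 by (simp add: reflect_funpow)
    ultimately obtain z where "(left_lim ?h ^^ q) z = z + of_int (- p)"
      using left_lim_periodic_point[OF h q rot_h] by blast
    then have "rotation_number (left_lim ?h) = of_int (- p) / real q"
      by (rule rotation_number_eq[OF lift_maps_left_lim[OF h] q])
    then show ?thesis using right rot f h
      by (simp add: left_lim_conv_reflect rotation_number_reflect lift_maps_right_lim)
  qed
qed (use periodic in blast)

section \<open>Periodic orbits in increasing order\<close>

text \<open>For \<open>a * p - b * q = 1\<close> the map \<open>f\<^sup>a - b\<close> moves each point of the periodic
  orbit (taken modulo 1) to the next one on its right, and so lists the orbit in increasing order.\<close>
lemma ordered_periodic_orbit:
  fixes p :: int and q :: nat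
  assumes f: "f \<in> lift_maps" and q: "q > 0" and cop: "coprime p (int q)"
    and x: "(f ^^ q) x = x + of_int p"
  obtains y :: "int \<Rightarrow> real"
  where "strict_mono y" "\<And>i. y (i + int q) = y i + 1" "\<And>i. f (y i) = y (i + p)"
proof -
  \<comment> \<open>Extends the orbit of \<open>x\<close> to negative times, although
    \<open>f\<close> need not be invertible, through the rule that \<open>q\<close> steps translate
    by \<open>p\<close>.\<close>
  define \<phi> :: "int \<Rightarrow> real"
    where "\<phi> n = (f ^^ nat (n mod int q)) x + of_int (p * (n div int q))" for n
  have \<phi>_q: "\<phi> (n + int q * k) = \<phi> n + of_int (p * k)" for n k
    using q by (simp add: \<phi>_def algebra_simps)
  have \<phi>_Suc: "f (\<phi> n) = \<phi> (n + 1)" for n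
  proof -
    define r d where "r = nat (n mod int q)" and "d = n div int q"
    have n: "n = int r + int q * d" and r: "r < q" using q by (auto simp: r_def d_def nat_less_iff)
    have "f (\<phi> n) = (f ^^ Suc r) x + of_int (p * d)"
      unfolding \<phi>_def r_def d_def by (simp only: lift_maps_add_int[OF f] funpow.simps comp_apply)
    also have "(f ^^ Suc r) x = \<phi> (int (Suc r))"
    proof (cases "Suc r = q")
      case True
      then show ?thesis using q x by (simp only: True) (simp add: \<phi>_def)
    next
      case False
      then have "Suc r < q" using r by simp
      then have "int (Suc r) mod int q = int (Suc r)" "int (Suc r) div int q = 0"
        by (simp_all del: of_nat_Suc)
      then show ?thesis by (simp add: \<phi>_def del: of_nat_Suc funpow.simps)
    qed
    also have "\<dots> + of_int (p * d) = \<phi> (int (Suc r) + int q * d)" by (simp only: \<phi>_q)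
    finally show ?thesis by (simp add: n add_ac)
  qed
  have \<phi>_funpow: "(f ^^ k) (\<phi> n) = \<phi> (n + int k)" for n k
    by (induction k) (auto simp: \<phi>_Suc add_ac)
  obtain a b where ab: "a * p - b * int q = 1" "a > 0"
  proof -
    obtain u v where uv: "u * p + v * int q = 1"
      using bezout_int[of p "int q"] cop by auto
    \<comment> \<open>The Bezout coefficient of \<open>p\<close> is shifted by a large multiple of
      \<open>q\<close> to become positive, so that it can serve as an iteration exponent.\<close>
    have "(u + int q * (\<bar>u\<bar> + 1)) * p - (p * (\<bar>u\<bar> + 1) - v) * int q = 1"
      using uv by (simp add: algebra_simps)
    moreover have "1 * (\<bar>u\<bar> + 1) \<le> int q * (\<bar>u\<bar> + 1)" using q by (intro mult_right_mono) auto
    then have "- u < int q * (\<bar>u\<bar> + 1)" by (rule less_le_trans[rotated]) simp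
    then have "u + int q * (\<bar>u\<bar> + 1) > 0" by simp
    ultimately show ?thesis using that by blast
  qed
  define y where "y i = \<phi> (a * i) - of_int (b * i)" for i
  have y_q: "y (i + int q) = y i + 1" for i
  proof -
    have "y (i + int q) = \<phi> (a * i + int q * a) - of_int (b * (i + int q))"
      by (simp add: y_def algebra_simps)
    also have "\<dots> = y i + of_int (a * p - b * int q)"
      by (simp only: \<phi>_q y_def) (simp add: algebra_simps)
    finally show ?thesis by (simp add: ab(1))
  qed
  \<comment> \<open>One step of \<open>f\<close> is \<open>p\<close> steps in the order of the
    orbit, because \<open>1 + b * q = a * p\<close>.\<close>
  have y_f: "f (y i) = y (i + p)" for i
  proof -
    have "f (y i) = \<phi> (a * i + 1) + of_int (- (b * i))"
      using lift_maps_add_int[OF f, of "\<phi> (a * i)" "- (b * i)"] by (simp add: y_def \<phi>_Suc)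
    also have "\<dots> = \<phi> (a * i + 1 + int q * b) - of_int (b * (i + p))"
      by (simp only: \<phi>_q) (simp add: algebra_simps)
    also have "a * i + 1 + int q * b = a * (i + p)" using ab(1) by (simp add: algebra_simps)
    finally show ?thesis by (simp add: y_def)
  qed
  have y_Suc: "y (i + 1) = (f ^^ nat a) (y i) - of_int b" for i
    using lift_maps_add_int[OF lift_maps_funpow[OF f], of "nat a" "\<phi> (a * i)" "- (b * i)"] ab(2)
    by (simp add: y_def \<phi>_funpow algebra_simps)
  \<comment> \<open>A single failure to move right would persist under the monotone map
    \<open>f ^^ nat a\<close>, making \<open>y\<close> nonincreasing from \<open>i\<close> on,
    whereas \<open>q\<close> steps must gain 1.\<close>
  have step: "y i < y (i + 1)" for i
  proof (rule ccontr)
    assume *: "\<not> y i < y (i + 1)"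
    have "y (i + int k + 1) \<le> y (i + int k)" for k
    proof (induction k)
      case (Suc k)
      have "(f ^^ nat a) (y (i + int k + 1)) \<le> (f ^^ nat a) (y (i + int k))"
        by (rule lift_maps_mono[OF lift_maps_funpow[OF f] Suc])
      then show ?case using y_Suc[of "i + int k"] y_Suc[of "i + int k + 1"]
        by (simp add: add_ac)
    qed (use * in simp)
    then have dec: "y (i + int (Suc k)) \<le> y (i + int k)" for k by (simp add: add_ac)
    have "y (i + int q) \<le> y (i + int 0)"
      by (rule lift_Suc_antimono_le[of "\<lambda>k. y (i + int k)", OF dec]) simp
    then show False using y_q[of i] by simp
  qed
  have "y i < y (i + int (Suc k))" for i k
  proof (induction k)
    case (Suc k)
    then show ?case using step[of "i + int (Suc k)"] by (simp add: add_ac)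
  qed (use step in simp)
  then have "strict_mono y"
    by (intro strict_monoI) (metis add_diff_cancel_left' zless_iff_Suc_zadd)
  then show ?thesis using that y_q y_f by blast
qed

section \<open>Orbits advancing at the largest possible rate\<close>

lemma add_int_mult_period:
  fixes y :: "int \<Rightarrow> real"
  assumes "\<And>i. y (i + q) = y i + 1"
  shows "y (i + q * k) = y i + of_int k"
proof (induction k rule: int_induct[where k = 0])
  case (step1 k)
  then show ?case using assms[of "i + q * k"] by (simp add: algebra_simps)
next
  case (step2 k)
  then show ?case using assms[of "i + q * (k - 1)"] by (simp add: algebra_simps)
qed simp

text \<open>A step raises the index by at most \<open>p + 1\<close>, and by \<open>le\<close> a
  point lying strictly below \<open>y i\<close> cannot get beyond \<open>y (i + p)\<close>. So one
  missed step costs a whole index for good. If every orbit had a miss, the average advance would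
  fall below \<open>p + 1\<close> and the rotation number below \<open>(p + 1) / q\<close>.\<close>

lemma extremal_orbit:
  fixes y :: "int \<Rightarrow> real" and p :: int and q :: nat
  assumes g: "g \<in> lift_maps" and q: "q > 0" and rot: "rotation_number g = of_int (p + 1) / real q"
    and mono: "strict_mono y" and per: "\<And>i. y (i + int q) = y i + 1"
    and le: "\<And>x i. x < y i \<Longrightarrow> g x \<le> y (i + p)"
  shows "\<exists>j. \<forall>n. g (y (j + (p + 1) * n)) = y (j + (p + 1) * (n + 1))"
proof -
  note per' = add_int_mult_period[of y "int q", OF per]
  have le1: "g (y i) \<le> y (i + p + 1)" for i
    using le[of "y i" "i + 1"] mono by (simp add: strict_mono_def add_ac)
  have pow_le: "(g ^^ n) (y i) \<le> y (i + (p + 1) * int n)" for n i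
  proof (induction n)
    case (Suc n)
    have "(g ^^ Suc n) (y i) \<le> g (y (i + (p + 1) * int n))"
      using lift_maps_mono[OF g Suc] by simp
    also have "\<dots> \<le> y (i + (p + 1) * int n + p + 1)" by (rule le1)
    finally show ?case by (simp add: algebra_simps)
  qed simp
  have pow_le_Suc: "(g ^^ Suc k) x \<le> y (i + (p + 1) * int (Suc k) - 1)" if "x < y i" for x k i
  proof -
    have "(g ^^ k) (g x) \<le> (g ^^ k) (y (i + p))"
      by (rule lift_maps_mono[OF lift_maps_funpow[OF g] le[OF that]])
    also have "\<dots> \<le> y (i + p + (p + 1) * int k)" by (rule pow_le)
    finally show ?thesis by (simp add: funpow_swap1 algebra_simps)
  qed
  \<comment> \<open>The largest advance in \<open>q + 1\<close> steps, less the one lost index. A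
    miss can be found among the first \<open>q\<close> steps, and one further step turns its strict
    inequality into the lost index.\<close>
  define c where "c = (p + 1) * int (Suc q) - 1"
  have drop: "(g ^^ Suc q) (y j) \<le> y (j + c)"
    if n: "g (y (j + (p + 1) * n)) \<noteq> y (j + (p + 1) * (n + 1))" for j n
  proof -
    \<comment> \<open>By periodicity of \<open>y\<close>, whether step \<open>n\<close> is a miss
      depends only on \<open>n\<close> modulo \<open>q\<close>.\<close>
    define m where "m = nat (n mod int q)"
    have m: "m < q" and nm: "n = int m + int q * (n div int q)"
      using q by (auto simp: m_def nat_less_iff)
    define i where "i = j + (p + 1) * int m"
    have shift: "j + (p + 1) * n = i + int q * ((p + 1) * (n div int q))"
      by (subst nm) (simp add: i_def algebra_simps)
    have "g (y (i + int q * k)) = g (y i) + of_int k" for k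
      by (simp add: per' lift_maps_add_int[OF g])
    moreover have "y (j + (p + 1) * (n + 1)) = y (i + p + 1) + of_int ((p + 1) * (n div int q))"
    proof -
      have "j + (p + 1) * (n + 1) = i + p + 1 + int q * ((p + 1) * (n div int q))"
        using shift by (simp add: algebra_simps)
      then show ?thesis by (simp only: per')
    qed
    ultimately have "g (y i) \<noteq> y (i + p + 1)" using n by (simp only: shift)
    then have less: "g (y i) < y (i + p + 1)" using le1[of i] by simp
    have "(g ^^ Suc m) (y j) \<le> g (y i)"
      using lift_maps_mono[OF g pow_le[of m j]] by (simp add: i_def)
    then have "(g ^^ Suc (q - Suc m)) ((g ^^ Suc m) (y j)) \<le>
        y (i + p + 1 + (p + 1) * int (Suc (q - Suc m)) - 1)"
      using less by (intro pow_le_Suc) simp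
    moreover have "Suc (q - Suc m) + Suc m = Suc q" using m by simp
    then have "(g ^^ Suc (q - Suc m)) ((g ^^ Suc m) (y j)) = (g ^^ Suc q) (y j)"
      by (metis comp_apply funpow_add)
    moreover have "i + p + 1 + (p + 1) * int (Suc (q - Suc m)) - 1 = j + c"
      using m by (simp add: i_def c_def of_nat_diff algebra_simps)
    ultimately show ?thesis by simp
  qed
  show ?thesis
  proof (rule ccontr)
    assume "\<not> ?thesis"
    then have drop': "(g ^^ Suc q) (y j) \<le> y (j + c)" for j using drop by blast
    have "(g ^^ (Suc q * k)) (y 0) \<le> y (c * int k)" for k
    proof (induction k)
      case (Suc k)
      have "(g ^^ (Suc q * Suc k)) (y 0) = (g ^^ Suc q) ((g ^^ (Suc q * k)) (y 0))"
        by (simp only: mult_Suc_right funpow_add comp_apply)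
      also have "\<dots> \<le> (g ^^ Suc q) (y (c * int k))"
        by (rule lift_maps_mono[OF lift_maps_funpow[OF g] Suc])
      also have "\<dots> \<le> y (c * int k + c)" by (rule drop')
      finally show ?case by (simp add: algebra_simps)
    qed simp
    \<comment> \<open>After \<open>q\<close> blocks of \<open>q + 1\<close> steps the index has
      risen by at most \<open>c * q\<close>, which is a translation by \<open>c\<close>.\<close>
    from this[of q] have "(g ^^ (Suc q * q)) (y 0) \<le> y 0 + of_int c"
      using per'[of 0 c] by (simp add: mult.commute)
    then have "rotation_number g \<le> of_int c / real (Suc q * q)"
      using q by (intro rotation_number_le[OF g]) auto
    also have "\<dots> < of_int (p + 1) * real (Suc q) / real (Suc q * q)"
      using q by (intro divide_strict_right_mono) (simp_all add: c_def algebra_simps add_pos_pos)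
    also have "\<dots> = of_int (p + 1) / real q" by (simp del: of_nat_Suc mult_Suc)
    finally show False by (simp add: rot)
  qed
qed

section \<open>Incompatibility of the two extremal orbits for odd \<open>q\<close>\<close>

lemma no_periodic_orbit:
  fixes p :: int and q :: nat
  assumes f: "f \<in> lift_maps" and q: "odd q" and cop: "coprime p (int q)"
    and rot_left: "rotation_number (left_lim f) = of_int (p - 1) / real q"
    and rot_right: "rotation_number (right_lim f) = of_int (p + 1) / real q"
  shows "(f ^^ q) x \<noteq> x + of_int p"
proof
  assume x: "(f ^^ q) x = x + of_int p"
  have q0: "q > 0" using q by (rule odd_pos)
  obtain y where mono: "strict_mono y" and per: "\<And>i. y (i + int q) = y i + 1"
    and y_f: "\<And>i. f (y i) = y (i + p)"
    using ordered_periodic_orbit[OF f q0 cop x] by blast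
  have "\<exists>j. \<forall>n. right_lim f (y (j + (p + 1) * n)) = y (j + (p + 1) * (n + 1))"
  proof (rule extremal_orbit[of "right_lim f" q p y,
        OF lift_maps_right_lim[OF f] q0 rot_right mono per])
    show "right_lim f x \<le> y (i + p)" if "x < y i" for x i
      using right_lim_le[OF f that] by (simp add: y_f)
  qed
  then obtain j where j: "\<And>n. right_lim f (y (j + (p + 1) * n)) = y (j + (p + 1) * (n + 1))"
    by blast
  \<comment> \<open>The periodic orbit of \<open>reflect f\<close> in increasing order, with
    \<open>- p\<close> in the role of \<open>p\<close>; through it \<open>extremal_orbit\<close>
    also covers the left limit.\<close>
  define y' where "y' i = - y (- i)" for i
  let ?g = "right_lim (reflect f)"
  have g: "?g \<in> lift_maps" by (intro lift_maps_right_lim lift_maps_reflect f)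
  have rot_g: "rotation_number ?g = of_int (- p + 1) / real q"
    using rotation_number_reflect[OF g] rot_left q0
    by (simp add: left_lim_conv_reflect[OF f] field_simps)
  have "\<exists>k. \<forall>n. ?g (y' (k + (- p + 1) * n)) = y' (k + (- p + 1) * (n + 1))"
  proof (rule extremal_orbit[of ?g q "- p" y', OF g q0 rot_g])
    show "strict_mono y'" using mono by (simp add: y'_def strict_mono_def)
    show "y' (i + int q) = y' i + 1" for i using per[of "- i - int q"] by (simp add: y'_def)
    show "?g x \<le> y' (i + - p)" if "x < y' i" for x i
      using right_lim_le[OF lift_maps_reflect[OF f] that] y_f[of "- i"]
      by (simp add: y'_def reflect_def add.commute)
  qed
  then obtain k where k: "\<And>n. ?g (y' (k + (- p + 1) * n)) = y' (k + (- p + 1) * (n + 1))"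
    by blast
  \<comment> \<open>A common divisor of \<open>p + 1\<close> and \<open>p - 1\<close> divides their
    difference 2, so it is coprime to the odd number \<open>q\<close>.\<close>
  obtain u v w where uvw: "u * (p + 1) + v * (p - 1) + w * int q = 1"
  proof -
    define d where "d = gcd (p + 1) (p - 1)"
    define e where "e = gcd d (int q)"
    have e: "e dvd p + 1" "e dvd p - 1" "e dvd int q"
      unfolding d_def e_def by (meson dvd_trans gcd_dvd1 gcd_dvd2)+
    have "e dvd 2" using dvd_diff[OF e(1,2)] by simp
    moreover have "coprime 2 (int q)" using q by simp
    ultimately have "is_unit e" using e(3) coprime_common_divisor by blast
    then have "e = 1" by (simp add: e_def)
    then obtain a' b' where ab': "a' * d + b' * int q = 1"
      using bezout_int[of d "int q"] unfolding e_def by metis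
    obtain a b where ab: "a * (p + 1) + b * (p - 1) = d"
      using bezout_int[of "p + 1" "p - 1"] by (auto simp: d_def)
    have "(a' * a) * (p + 1) + (a' * b) * (p - 1) + b' * int q = 1"
      using ab' unfolding ab[symmetric] by (simp only: distrib_left mult.assoc)
    then show ?thesis using that by blast
  qed
  \<comment> \<open>In the indexing by \<open>y\<close>, the second orbit runs through
    \<open>- k\<close> plus multiples of \<open>p - 1\<close>. Hence \<open>D\<close> is the amount
    to be split among multiples of \<open>p + 1\<close>, \<open>p - 1\<close> and \<open>q\<close>,
    which the relation \<open>uvw\<close> scaled by \<open>D\<close> provides; \<open>J\<close>
    takes the shares of \<open>p + 1\<close> and \<open>q\<close>, and \<open>J + 1\<close> that of
    \<open>p - 1\<close>.\<close>
  define D where "D = - k - j - 1"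
  define J where "J = j + (p + 1) * (u * D) + int q * (w * D)"
  have J: "J + 1 = - (k + (- p + 1) * (- v * D))"
  proof -
    have "D * (u * (p + 1) + v * (p - 1) + w * int q) = D" by (simp add: uvw)
    then show ?thesis unfolding J_def by (simp add: D_def algebra_simps)
  qed
  have "y J < y (J + 1)" using mono by (simp add: strict_mono_def)
  then obtain x where x: "y J < x" "x < y (J + 1)" using dense by blast
  have "right_lim f (y J) = y (J + p + 1)"
  proof -
    have "right_lim f (y J) = right_lim f (y (j + (p + 1) * (u * D))) + of_int (w * D)"
      unfolding J_def add_int_mult_period[of y, OF per]
      by (rule lift_maps_add_int[OF lift_maps_right_lim[OF f]])
    also have "\<dots> = y (j + (p + 1) * (u * D + 1) + int q * (w * D))"
      by (simp only: j add_int_mult_period[of y, OF per])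
    finally show ?thesis by (simp add: J_def algebra_simps)
  qed
  then have "y (J + p + 1) \<le> f x" using right_lim_le[OF f x(1)] by simp
  \<comment> \<open>The reflected counterpart of the lower bound: \<open>y' ?i\<close> is
    \<open>- y (J + 1)\<close>, the right end of the gap seen in the mirror.\<close>
  moreover have "f x \<le> y (J + p)"
  proof -
    let ?i = "k + (- p + 1) * (- v * D)"
    have "- (k + (- p + 1) * (- v * D + 1)) = J + p"
      using J by (simp add: algebra_simps)
    then have "?g (y' ?i) = - y (J + p)" unfolding k by (simp only: y'_def)
    moreover have "y' ?i < - x" using x(2) unfolding y'_def J[symmetric] by simp
    ultimately show ?thesis
      using right_lim_le[OF lift_maps_reflect[OF f], of "y' ?i" "- x"] unfolding reflect_def
      by simp
  qed
  moreover have "y (J + p) < y (J + p + 1)" using mono by (simp add: strict_mono_def)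
  ultimately show False by simp
qed

theorem theorem1p9:
  fixes \<nu>m \<nu>p :: real and p q :: int
  assumes "\<nu>m < \<nu>p"
    and "q > 0" and "coprime p q"
    and "real_of_int p / real_of_int q \<in> S_set \<nu>m \<nu>p"
    and "real_of_int (p - 1) / real_of_int q = \<nu>m"
    and "real_of_int (p + 1) / real_of_int q = \<nu>p"
    and "odd q"
  shows "\<not> (\<exists>f \<in> lift_maps. rotation_number (left_lim f) = \<nu>m \<and>
               rotation_number (right_lim f) = \<nu>p \<and>
               rotation_number f = real_of_int p / real_of_int q)"
proof
  assume "\<exists>f \<in> lift_maps. rotation_number (left_lim f) = \<nu>m \<and>
               rotation_number (right_lim f) = \<nu>p \<and>
               rotation_number f = real_of_int p / real_of_int q"
  then obtain f where f: "f \<in> lift_maps"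
    and rot: "rotation_number (left_lim f) = \<nu>m" "rotation_number (right_lim f) = \<nu>p"
      "rotation_number f = real_of_int p / real_of_int q" by blast
  obtain n where n: "q = int n" using zero_le_imp_eq_int[of q] assms(2) by auto
  have n0: "n > 0" and rot_f: "rotation_number f = of_int p / real n"
    using assms(2) rot(3) n by simp_all
  show False
  \<comment> \<open>In the two one-sided cases \<open>p / q\<close> would have to equal
    \<open>(p - 1) / q\<close> or \<open>(p + 1) / q\<close>.\<close>
  proof (rule rational_rotation_number_cases[OF f n0 rot_f])
    fix x assume "(f ^^ n) x = x + real_of_int p"
    then show False
      using no_periodic_orbit[OF f, of n p x] assms(3,5,6,7) rot(1,2) n by simp
  next
    assume "rotation_number (left_lim f) = rotation_number f"
    then have "real_of_int (p - 1) / real_of_int q = real_of_int p / real_of_int q"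
      using rot assms(5) by simp
    then show False using assms(2) by simp
  next
    assume "rotation_number (right_lim f) = rotation_number f"
    then have "real_of_int (p + 1) / real_of_int q = real_of_int p / real_of_int q"
      using rot assms(6) by simp
    then show False using assms(2) by simp
  qed
qed

end
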